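(* Let $s,r,m$ be positive integers with $s\le r\le sm$, and put $n=sm$, $k=n-r$, $l=s^m$. Let $F$ be a finite field with $|F|\ge n$, let $\lambda_1,\dots,\lambda_n$ be distinct elements of $F$, and let $\gamma\in F\setminus\{0,1\}$. Let $$\mathcal C=\Big\{(C_1,\dots,C_n)\in (F^l)^n:\ \sum_{i=1}^n A_{t,i}C_i=0,\ t=0,1,\dots,r-1\Big\},$$ where the $l\times l$ matrices $A_{t,i}$ are those defined in the context. Partition the $n$ nodes into the $m$ groups $\{(v-1)s+1,(v-1)s+2,\dots,vs\}$, $v\in[m]$. Then $\mathcal C$ has the $(s,s+k-1)$-group optimal access property.
   Context: Conventions: $[n]=\{1,\dots,n\}$; $0^0=1$. Rows and columns of an $l\times l$ matrix $A$ are indexed by $0,1,\dots,l-1$, and $A(a,b)$ denotes the entry in row $a$, column $b$. An $(n,k,l)$ array code over $F$ (length $n$, dimension $k$, sub-packetization $l$) consists of $l\times n$ matrices $(C_1,\dots,C_n)\in(F^l)^n$, called codewords, with columns $C_i=(c_{i,0},\dots,c_{i,l-1})^T\in F^l$ (the $i$-th node). It is MDS if any $k$ of the $n$ columns $C_i$ of a codeword suffice to recover the remaining $n-k$ columns. Access. Let $\mathcal C$ be an $(n,k,l)$ MDS array code, $i\in[n]$ and $R\subseteq[n]\setminus\{i\}$ with $|R|\ge k$. Node $i$ can be repaired from the helper nodes $R$ by accessing $\omega$ symbols if there are numbers $\beta_{i,j},\omega_{i,j}$ ($j\in R$) with $\sum_{j\in R}\omega_{i,j}=\omega$, functions $f_{i,j}:F^l\to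 F^{\beta_{i,j}}$ ($j\in R$), where $f_{i,j}(C_j)$ depends on $\omega_{i,j}$ of the coordinates $c_{j,0},\dots,c_{j,l-1}$ of $C_j$, and a function $g_i:F^{\sum_j\beta_{i,j}}\to F^l$ such that $C_i=g_i(f_{i,j}(C_j),j\in R)$ for all codewords. Let $\omega_i^*(R)$ be the smallest such $\omega$. Group optimal access. Let $\mathcal C$ be an $(n=sm,k,l)$ MDS array code whose nodes are partitioned into $m$ groups of size $s$ each, and let $d=s+k-1$. $\mathcal C$ has the $(s,d)$-group optimal access property if $\omega_i^*(R)=dl/s$ for every $i\in[n]$ and every set of helper nodes $R\subseteq[n]\setminus\{i\}$ of size $d$ that contains all the $s-1$ other nodes from the same group as $i$. The matrices $A_{t,i}$. For an integer $a$ with $0\le a\le l-1$, write its $s$-ary expansion as $a=(a_m,a_{m-1},\dots,a_1)$, i.e. $a=\sum_{v=1}^m a_v s^{v-1}$ with $0\le a_v\le s-1$. For $v\in[m]$ and $0\le u\le s-1$ let $a(v,u)$ be the integer obtained from $a$ by replacing the digit $a_v$ by $u$ and keeping all other digits. Each $i\in[n]$ is written uniquely as $i=(v-1)s+u+1$ with $v\in[m]$, $u\in\{0,\dots,s-1\}$. For $t=0,\dots,r-1$ and $0\le a,b\le l-1$, $$A_{t,(v-1)s+u+1}(a,b)=\begin{cases}\lambda_{(v-1)s+u+1}^t & \text{if } a_v<u,\ b=a,\\ \gamma\lambda_{(v-1)s+u+1}^t & \text{if } a_v>u,\ b=a,\\ \lambda_{(v-1)s+w+1}^t & \text{if } a_v=u,\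 b=a(v,w)\text{ for some } w\in\{0,1,\dots,s-1\},\\ 0&\text{otherwise.}\end{cases}$$
   Formalization: The case r = sm with s > 1 is excluded: there k = 0, the only codeword is 0, so every node is repaired by accessing 0 symbols while dl/s = (s−1)s^(m−1) > 0, and the claim as stated is false. *)

theory Defs
  imports "Jordan_Normal_Form.Matrix" "HOL-Library.Disjoint_Sets" "HOL-Library.Cardinality"
begin

text \<open>
  Codewords are families of column vectors indexed by \<open>{1..n}\<close>, extensional so that
  equality and cardinality are meaningful; the nodes are numbered from 1, whereas the coordinates
  of a node and the rows and columns of a matrix are numbered from 0.
\<close>

text \<open>Over the finite field \<open>F\<close>, ``dimension \<open>k\<close>'' of a code with columns in \<open>F^l\<close>
  means that it has \<open>|F|^(k l)\<close> codewords.\<close>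

definition array_code :: "nat \<Rightarrow> nat \<Rightarrow> nat \<Rightarrow> (nat \<Rightarrow> 'a::{field,finite} vec) set \<Rightarrow> bool" where
  "array_code n k l \<C> \<longleftrightarrow>
     \<C> \<subseteq> ({1..n} \<rightarrow>\<^sub>E carrier_vec l) \<and> card \<C> = CARD('a) ^ (k * l)"

definition mds_array_code :: "nat \<Rightarrow> nat \<Rightarrow> nat \<Rightarrow> (nat \<Rightarrow> 'a::{field,finite} vec) set \<Rightarrow> bool" where
  "mds_array_code n k l \<C> \<longleftrightarrow>
     array_code n k l \<C> \<and>
     (\<forall>S \<subseteq> {1..n}. card S = k \<longrightarrow>
        (\<forall>C \<in> \<C>. \<forall>D \<in> \<C>. (\<forall>j\<in>S. C j = D j) \<longrightarrow> (\<forall>j\<in>{1..n} - S. C j = D j)))"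

definition depends_on_coords ::
    "nat \<Rightarrow> nat set \<Rightarrow> ('a vec \<Rightarrow> 'b) \<Rightarrow> bool" where
  "depends_on_coords l S f \<longleftrightarrow>
     (\<forall>x \<in> carrier_vec l. \<forall>y \<in> carrier_vec l. (\<forall>a\<in>S. x $ a = y $ a) \<longrightarrow> f x = f y)"

text \<open>The domain \<open>F^(\<Sum>j\<in>R. \<beta> j)\<close> of the decoding function \<open>g\<close> is rendered as the product
  over \<open>j \<in> R\<close> of the spaces \<open>F^(\<beta> j)\<close>.\<close>

definition repairable_by_access ::
    "nat \<Rightarrow> (nat \<Rightarrow> 'a vec) set \<Rightarrow> nat \<Rightarrow> nat set \<Rightarrow> nat \<Rightarrow> bool" where
  "repairable_by_access l \<C> i R \<omega> \<longleftrightarrow>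
     (\<exists>(\<beta> :: nat \<Rightarrow> nat) (\<omega>' :: nat \<Rightarrow> nat) (f :: nat \<Rightarrow> 'a vec \<Rightarrow> 'a vec)
        (g :: (nat \<Rightarrow> 'a vec) \<Rightarrow> 'a vec).
        (\<Sum>j\<in>R. \<omega>' j) = \<omega> \<and>
        (\<forall>j\<in>R. f j \<in> carrier_vec l \<rightarrow> carrier_vec (\<beta> j) \<and>
           (\<exists>S \<subseteq> {..<l}. card S = \<omega>' j \<and> depends_on_coords l S (f j))) \<and>
        g \<in> (\<Pi>\<^sub>E j\<in>R. carrier_vec (\<beta> j)) \<rightarrow> carrier_vec l \<and>
        (\<forall>C \<in> \<C>. C i = g (\<lambda>j\<in>R. f j (C j))))"

definition min_access :: "nat \<Rightarrow> (nat \<Rightarrow> 'a vec) set \<Rightarrow> nat \<Rightarrow> nat set \<Rightarrow> nat" where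
  "min_access l \<C> i R = (LEAST \<omega>. repairable_by_access l \<C> i R \<omega>)"

text \<open>In \<open>group_optimal_access s d n k l P \<C>\<close> the partition of the nodes into groups is \<open>P\<close>.
  The MDS property, a standing assumption of the notion, is part of the definition; it also
  guarantees that the minimum in \<^const>\<open>min_access\<close> is taken over a nonempty set. For \<open>k = 0\<close> an MDS code has a single codeword,
  so that \<^const>\<open>min_access\<close> is \<open>0\<close> and the property fails as soon as \<open>s > 1\<close> and \<open>l, n > 0\<close>.\<close>

definition group_optimal_access ::
    "nat \<Rightarrow> nat \<Rightarrow> nat \<Rightarrow> nat \<Rightarrow> nat \<Rightarrow> nat set set \<Rightarrow> (nat \<Rightarrow> 'a::{field,finite} vec) set \<Rightarrow> bool"
  where
  "group_optimal_access s d n k l P \<C> \<longleftrightarrow>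
     d = s + k - 1 \<and> mds_array_code n k l \<C> \<and>
     partition_on {1..n} P \<and> (\<forall>G\<in>P. card G = s) \<and>
     (\<forall>G\<in>P. \<forall>i\<in>G. \<forall>R \<subseteq> {1..n} - {i}. card R = d \<longrightarrow> G - {i} \<subseteq> R \<longrightarrow>
        real (min_access l \<C> i R) = real d * real l / real s)"

definition digit :: "nat \<Rightarrow> nat \<Rightarrow> nat \<Rightarrow> nat" where
  "digit s a v = a div s ^ (v - 1) mod s"

definition replace_digit :: "nat \<Rightarrow> nat \<Rightarrow> nat \<Rightarrow> nat \<Rightarrow> nat \<Rightarrow> nat" where
  "replace_digit s m a v u = (\<Sum>w = 1..m. (if w = v then u else digit s a w) * s ^ (w - 1))"

text \<open>Node \<open>i = (v - 1) s + u + 1\<close> is decoded to \<open>v\<close> and \<open>u\<close> by division with remainder. In the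
  third case, the \<open>w\<close> with \<open>b = a(v,w)\<close> is the digit \<open>b\<^sub>v\<close>.\<close>

definition A_mat ::
    "nat \<Rightarrow> nat \<Rightarrow> 'a::field \<Rightarrow> (nat \<Rightarrow> 'a) \<Rightarrow> nat \<Rightarrow> nat \<Rightarrow> 'a mat" where
  "A_mat s m \<gamma> lam t i =
     (let v = (i - 1) div s + 1; u = (i - 1) mod s in
      mat (s ^ m) (s ^ m) (\<lambda>(a, b).
        if digit s a v < u \<and> b = a then lam i ^ t
        else if digit s a v > u \<and> b = a then \<gamma> * lam i ^ t
        else if digit s a v = u \<and> (\<exists>w<s. b = replace_digit s m a v w)
          then lam ((v - 1) * s + digit s b v + 1) ^ t
        else 0))"

definition the_code :: "nat \<Rightarrow> nat \<Rightarrow> nat \<Rightarrow> 'a::field \<Rightarrow> (nat \<Rightarrow> 'a) \<Rightarrow> (nat \<Rightarrow> 'a vec) set" where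
  "the_code s r m \<gamma> lam =
     {C \<in> {1..s * m} \<rightarrow>\<^sub>E carrier_vec (s ^ m).
        \<forall>t<r. finsum_vec TYPE('a) (s ^ m) (\<lambda>i. A_mat s m \<gamma> lam t i *\<^sub>v C i) {1..s * m}
               = 0\<^sub>v (s ^ m)}"

definition node_groups :: "nat \<Rightarrow> nat \<Rightarrow> nat set set" where
  "node_groups s m = (\<lambda>v. {(v - 1) * s + 1..v * s}) ` {1..m}"

end

(* Couple the symbols of a codeword by y(a, (v,w)) = e c(v,w)_a + c(v,a_v)_{a(v,w)}, where e is 1, gamma or 0
   according as a_v < w, a_v > w or a_v = w. The parity checks then say that every row y(a, -) satisfies the
   Vandermonde checks sum_j lambda_j^t y(a, j) = 0, t < r, so a row vanishing outside r positions is zero.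
   Let a codeword vanish outside a set E of r nodes. The coupled row a involves, besides symbols of E in row a
   and rows of the same weight #{v. (v, a_v) in E}, only symbols in rows of smaller weight; so by induction on
   the weight the row y(a, -) vanishes, and the symbols are recovered from pairs of equations with determinant
   gamma - 1. This gives the MDS property. Repairing node (v,u) uses only the rows with a_v = u: there the
   coupled symbols of group v are, up to known helper symbols, exactly all coordinates of the failed node.

   Conversely, fix k - 1 of the helpers to be zero: the failed node is still arbitrary, hence the other s helpers
   deliver at least l symbols. Averaging over the s-subsets of the helpers gives the lower bound. *)

theory Submission
  imports Defs "Berlekamp_Zassenhaus.Berlekamp_Type_Based"
begin

section \<open>Digits in base \<open>s\<close>, and two general tools\<close>

lemma digit_lt [simp]: "s > 0 \<Longrightarrow> digit s a v < s"
  by (simp add: digit_def)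

lemma sum_digits_mod: "(\<Sum>w = 1..m. digit s a w * s ^ (w - 1)) = a mod s ^ m"
proof (induction m)
  case (Suc m)
  then show ?case
    by (simp add: digit_def mod_mult2_eq mult.commute[of s])
qed simp

text \<open>One induction on \<open>m\<close> carries both claims: the top digit of the longer sum
  can be read off only because the shorter sum is known to stay below \<open>s ^ m\<close>.\<close>

lemma
  assumes "\<And>w. w \<in> {1..m} \<Longrightarrow> e w < s"
  shows digit_expansion_lt: "(\<Sum>w = 1..m. e w * s ^ (w - 1)) < s ^ m" (is "?X m < _")
    and digit_expansion: "v \<in> {1..m} \<Longrightarrow> digit s (\<Sum>w = 1..m. e w * s ^ (w - 1)) v = e v"
proof -
  have "?X m < s ^ m \<and> (\<forall>v\<in>{1..m}. digit s (?X m) v = e v)"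
    using assms
  proof (induction m)
    case (Suc m)
    then have lt: "?X m < s ^ m" and dig: "\<forall>v\<in>{1..m}. digit s (?X m) v = e v" and e: "e (Suc m) < s"
      by auto
    have eq: "?X (Suc m) = ?X m + e (Suc m) * s ^ m" by simp
    have "?X (Suc m) < (e (Suc m) + 1) * s ^ m"
      using lt by (simp add: eq)
    also have "\<dots> \<le> s * s ^ m"
      using e by (intro mult_right_mono) auto
    finally have lt': "?X (Suc m) < s ^ Suc m" by simp
    have "digit s (?X (Suc m)) v = e v" if v: "v \<in> {1..Suc m}" for v
    proof (cases "v = Suc m")
      case True
      then show ?thesis using lt e by (simp add: eq digit_def)
    next
      case False
      then have vm: "v \<in> {1..m}" using v by auto
      \<comment> \<open>The new top summand is a multiple of \<open>s ^ v\<close>. Dividing it by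
        \<open>s ^ (v - 1)\<close> leaves a multiple of \<open>s\<close>, which is invisible modulo
        \<open>s\<close>.\<close>
      have "m = (v - 1) + Suc (m - v)" using vm by auto
      then have "s ^ m = s ^ (v - 1) * (s * s ^ (m - v))"
        by (metis power_add power_Suc)
      then have split: "?X (Suc m) = ?X m + s ^ (v - 1) * (e (Suc m) * s ^ (m - v) * s)"
        by (simp add: eq)
      have "s ^ (v - 1) \<noteq> 0" using e by auto
      then have "?X (Suc m) div s ^ (v - 1) = e (Suc m) * s ^ (m - v) * s + ?X m div s ^ (v - 1)"
        unfolding split by (rule div_mult_self2)
      then show ?thesis using dig vm by (simp add: digit_def)
    qed
    with lt' show ?case by blast
  qed simp
  then show "?X m < s ^ m" and "v \<in> {1..m} \<Longrightarrow> digit s (?X m) v = e v" by auto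
qed

lemma digits_eqI:
  assumes "a < s ^ m" "b < s ^ m" "\<And>w. w \<in> {1..m} \<Longrightarrow> digit s a w = digit s b w"
  shows "a = b"
proof -
  have "a mod s ^ m = b mod s ^ m"
    unfolding sum_digits_mod[symmetric] using assms(3) by simp
  with assms show ?thesis by simp
qed

lemma replace_digit_lt: "u < s \<Longrightarrow> replace_digit s m a v u < s ^ m"
  unfolding replace_digit_def by (rule digit_expansion_lt) auto

lemma digit_replace_digit:
  "u < s \<Longrightarrow> w \<in> {1..m} \<Longrightarrow>
    digit s (replace_digit s m a v u) w = (if w = v then u else digit s a w)"
  unfolding replace_digit_def by (rule digit_expansion) auto

lemma replace_digit_same:
  assumes "a < s ^ m" "digit s a v = u"
  shows "replace_digit s m a v u = a"
proof -
  have "(if w = v then u else digit s a w) = digit s a w" for w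
    using assms by simp
  with assms show ?thesis
    unfolding replace_digit_def by (simp only: sum_digits_mod mod_less)
qed

lemma replace_digit_twice:
  "s > 0 \<Longrightarrow> u < s \<Longrightarrow> w < s \<Longrightarrow> v \<in> {1..m} \<Longrightarrow>
    replace_digit s m (replace_digit s m a v u) v w = replace_digit s m a v w"
  by (rule digits_eqI[where s = s and m = m]) (auto simp: replace_digit_lt digit_replace_digit)

text \<open>Overwriting digit \<open>v\<close> maps each digit class injectively into any other,
  since writing the old common digit back undoes it. So the \<open>s\<close> classes that partition
  the rows have equal size.\<close>

lemma card_digit_class:
  assumes "v \<in> {1..m}" "u < s"
  shows "s * card {a. a < s ^ m \<and> digit s a v = u} = s ^ m"
proof -
  define K where "K w = {a. a < s ^ m \<and> digit s a v = w}" for w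
  have fin [simp]: "finite (K w)" for w by (auto simp: K_def)
  have le: "card (K w) \<le> card (K w')" if "w < s" "w' < s" for w w'
  proof (rule card_inj_on_le)
    show "(\<lambda>a. replace_digit s m a v w') ` K w \<subseteq> K w'"
      using that assms by (auto simp: K_def replace_digit_lt digit_replace_digit)
    show "inj_on (\<lambda>a. replace_digit s m a v w') (K w)"
    proof (rule inj_onI)
      fix a b assume ab: "a \<in> K w" "b \<in> K w" "replace_digit s m a v w' = replace_digit s m b v w'"
      then have "replace_digit s m a v w = replace_digit s m b v w"
        using that assms by (metis replace_digit_twice gr_implies_not0 neq0_conv)
      with ab show "a = b" by (simp add: K_def replace_digit_same)
    qed
  qed simp
  have "{..<s ^ m} = (\<Union>w<s. K w)"
    using assms(2) by (auto simp: K_def)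
  then have "s ^ m = card (\<Union>w<s. K w)" by (metis card_lessThan)
  also have "\<dots> = (\<Sum>w<s. card (K w))"
    by (rule card_UN_disjoint) (auto simp: K_def)
  also have "\<dots> = (\<Sum>w<s. card (K u))"
    using le assms(2) by (intro sum.cong refl antisym) auto
  finally show ?thesis by (simp add: K_def)
qed

text \<open>The checks combine to \<open>\<Sum>i\<in>A. poly p (lam i) * y i = 0\<close> for every
  polynomial \<open>p\<close> of degree below \<open>r\<close>. Placing the roots of
  \<open>p\<close> at \<open>lam i\<close> for all \<open>i\<close> in \<open>E\<close> except
  \<open>j\<close> isolates \<open>y j\<close>.\<close>

lemma vandermonde_kernel:
  fixes y lam :: "nat \<Rightarrow> 'a::field"
  assumes "finite A" "E \<subseteq> A" "card E \<le> r" "inj_on lam E"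
    and zero: "\<And>j. j \<in> A - E \<Longrightarrow> y j = 0"
    and eqs: "\<And>t. t < r \<Longrightarrow> (\<Sum>j\<in>A. lam j ^ t * y j) = 0"
    and "j \<in> A"
  shows "y j = 0"
proof (cases "j \<in> E")
  case True
  have finE: "finite E" using assms(1,2) finite_subset by blast
  define p where "p = (\<Prod>i\<in>E - {j}. [:- lam i, 1:])"
  have "degree p \<le> (\<Sum>i\<in>E - {j}. degree [:- lam i, 1:])"
    unfolding p_def using degree_prod_sum_le[of "E - {j}" "\<lambda>i. [:- lam i, 1:]"] finE by (simp add: o_def)
  also have "\<dots> = card E - 1" using True finE by simp
  \<comment> \<open>As \<open>j\<close> lies in \<open>E\<close>, \<open>card E\<close> is positive
    and \<open>card E - 1\<close> is strictly below \<open>r\<close>.\<close>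
  finally have deg: "degree p < r"
    using assms(3) True finE by (metis Suc_diff_1 card_gt_0_iff empty_iff le_less_trans le_imp_less_Suc order_less_le_trans)
  have poly_p: "poly p x = (\<Prod>i\<in>E - {j}. x - lam i)" for x
    by (simp add: p_def poly_prod)
  have "(\<Sum>i\<in>A. poly p (lam i) * y i) = (\<Sum>i\<in>A. \<Sum>t\<le>degree p. coeff p t * (lam i ^ t * y i))"
    by (simp add: poly_altdef sum_distrib_right mult.assoc)
  also have "\<dots> = (\<Sum>t\<le>degree p. coeff p t * (\<Sum>i\<in>A. lam i ^ t * y i))"
    by (subst sum.swap) (simp add: sum_distrib_left)
  also have "\<dots> = 0" using eqs deg by simp
  finally have "0 = (\<Sum>i\<in>A. poly p (lam i) * y i)" by simp
  also have "\<dots> = (\<Sum>i\<in>{j}. poly p (lam i) * y i)"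
  proof (rule sum.mono_neutral_right)
    show "\<forall>i\<in>A - {j}. poly p (lam i) * y i = 0"
    proof
      fix i assume "i \<in> A - {j}"
      then show "poly p (lam i) * y i = 0"
        using zero[of i] finE by (cases "i \<in> E") (auto simp: poly_p)
    qed
  qed (use assms in auto)
  finally have "poly p (lam j) * y j = 0" by simp
  moreover have "poly p (lam j) \<noteq> 0"
    using True assms(4) finE by (auto simp: poly_p inj_on_def)
  ultimately show ?thesis by simp
qed (use zero assms in auto)

text \<open>Averaging by deleting one element at a time: every \<open>X - {x}\<close> satisfies the
  bound by induction, and summing over \<open>x\<close> counts each weight \<open>card X - 1\<close>
  times.\<close>

lemma average_bound:
  fixes \<omega> :: "nat \<Rightarrow> nat"
  assumes "s > 0" "finite X" "s \<le> card X"
    and "\<And>U. U \<subseteq> X \<Longrightarrow> card U = s \<Longrightarrow> l \<le> sum \<omega> U"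
  shows "card X * l \<le> s * sum \<omega> X"
  using assms(2-)
proof (induction "card X - s" arbitrary: X)
  case 0
  then show ?case by auto
next
  case (Suc d)
  obtain c where c: "card X = Suc c" "s \<le> c"
    using Suc.hyps(2) by (cases "card X") auto
  have "c * l \<le> s * sum \<omega> (X - {x})" if "x \<in> X" for x
    using Suc.hyps(1)[of "X - {x}"] Suc.hyps(2) Suc.prems c that by (auto simp: subset_Diff_insert)
  then have "(\<Sum>x\<in>X. c * l) \<le> (\<Sum>x\<in>X. s * sum \<omega> (X - {x}))"
    by (intro sum_mono)
  \<comment> \<open>The added \<open>s * sum \<omega> X\<close> supplies the deleted terms, so that
    every inner sum on the right becomes the full one.\<close>
  then have "Suc c * (c * l) + s * sum \<omega> X \<le> s * (\<Sum>x\<in>X. sum \<omega> (X - {x}) + \<omega> x)"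
    by (simp add: c sum_distrib_left sum.distrib distrib_left)
  also have "(\<Sum>x\<in>X. sum \<omega> (X - {x}) + \<omega> x) = (\<Sum>x\<in>X. sum \<omega> X)"
    using Suc.prems by (intro sum.cong refl) (simp add: sum.remove add.commute)
  finally have "c * (Suc c * l) \<le> c * (s * sum \<omega> X)"
    by (simp add: c algebra_simps)
  \<comment> \<open>The factor \<open>c\<close> is at least \<open>s\<close>, hence positive, and
    cancels.\<close>
  with c assms(1) show ?case by simp
qed

section \<open>Nodes as pairs of a group and a position\<close>

definition node :: "nat \<Rightarrow> nat \<Rightarrow> nat \<Rightarrow> nat" where
  "node s v u = (v - 1) * s + u + 1"

definition group_of :: "nat \<Rightarrow> nat \<Rightarrow> nat" where
  "group_of s j = (j - 1) div s + 1"

definition pos_of :: "nat \<Rightarrow> nat \<Rightarrow> nat" where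
  "pos_of s j = (j - 1) mod s"

lemma pos_of_lt [simp]: "s > 0 \<Longrightarrow> pos_of s j < s"
  by (simp add: pos_of_def)

lemma group_of_node [simp]: "u < s \<Longrightarrow> v > 0 \<Longrightarrow> group_of s (node s v u) = v"
  by (simp add: group_of_def node_def)

lemma pos_of_node [simp]: "u < s \<Longrightarrow> pos_of s (node s v u) = u"
  by (simp add: pos_of_def node_def)

lemma node_group_pos [simp]: "j > 0 \<Longrightarrow> node s (group_of s j) (pos_of s j) = j"
  by (simp add: group_of_def pos_of_def node_def)

lemma group_of_in: "j \<in> {1..s * m} \<Longrightarrow> group_of s j \<in> {1..m}"
  by (auto simp: group_of_def Suc_le_eq less_mult_imp_div_less mult.commute)

lemma node_in: "v \<in> {1..m} \<Longrightarrow> u < s \<Longrightarrow> node s v u \<in> {1..s * m}"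
proof -
  assume "v \<in> {1..m}" "u < s"
  then have "node s v u \<le> (v - 1) * s + s" by (simp add: node_def)
  also have "\<dots> = v * s" using \<open>v \<in> {1..m}\<close> by (cases v) auto
  also have "\<dots> \<le> m * s" using \<open>v \<in> {1..m}\<close> by simp
  finally show ?thesis by (simp add: node_def mult.commute)
qed

lemma sum_nodes:
  "s > 0 \<Longrightarrow> sum g {1..s * m} = (\<Sum>v\<in>{1..m}. \<Sum>u<s. g (node s v u))"
  unfolding sum.cartesian_product
  by (rule sum.reindex_bij_witness[of _ "\<lambda>(v, u). node s v u" "\<lambda>j. (group_of s j, pos_of s j)"])
     (use group_of_in node_in in fastforce)+

text \<open>Turns the intervals of \<open>node_groups\<close> into fibres of
  \<open>group_of\<close>, the form in which repair and partition are treated.\<close>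

lemma node_groups_eq:
  assumes "v \<in> {1..m}" "s > 0"
  shows "{(v - 1) * s + 1..v * s} = {j \<in> {1..s * m}. group_of s j = v}"
proof -
  have "j \<in> {(v - 1) * s + 1..v * s} \<longleftrightarrow> j \<in> {1..s * m} \<and> group_of s j = v" for j
  proof
    assume j: "j \<in> {(v - 1) * s + 1..v * s}"
    have "v * s = (v - 1) * s + s" using assms by (cases v) auto
    then have "j = node s v (j - 1 - (v - 1) * s)" "j - 1 - (v - 1) * s < s"
      using j by (auto simp: node_def)
    then show "j \<in> {1..s * m} \<and> group_of s j = v"
      using node_in[OF assms(1)] group_of_node assms by (metis atLeastAtMost_iff less_eq_Suc_le One_nat_def)
  next
    assume j: "j \<in> {1..s * m} \<and> group_of s j = v"
    have "v * s = (v - 1) * s + s" using assms by (cases v) auto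
    moreover have "j = node s v (pos_of s j)" using j node_group_pos[of j s] by auto
    moreover have "pos_of s j < s" using assms by simp
    ultimately show "j \<in> {(v - 1) * s + 1..v * s}" by (simp add: node_def)
  qed
  then show ?thesis by blast
qed

lemma depends_on_coordsD:
  "depends_on_coords l S f \<Longrightarrow> x \<in> carrier_vec l \<Longrightarrow> y \<in> carrier_vec l \<Longrightarrow>
    (\<And>a. a \<in> S \<Longrightarrow> x $ a = y $ a) \<Longrightarrow> f x = f y"
  unfolding depends_on_coords_def by blast

section \<open>Coupled symbols and the parity checks\<close>

locale coupled_code =
  fixes s m r :: nat and \<gamma> :: "'a::{field,finite}" and lam :: "nat \<Rightarrow> 'a"
  assumes s_pos: "s > 0" and r_le: "r \<le> s * m"
    and inj_lam: "inj_on lam {1..s * m}"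
    and gamma: "\<gamma> \<noteq> 0" "\<gamma> \<noteq> 1"
begin

abbreviation "n \<equiv> s * m"
abbreviation "l \<equiv> s ^ m"
abbreviation "k \<equiv> n - r"
abbreviation "dig \<equiv> digit s"
abbreviation "rep \<equiv> replace_digit s m"
abbreviation "code \<equiv> the_code s r m \<gamma> lam"

text \<open>The diagonal entry of \<open>A_mat\<close> without its power of \<open>lam\<close>, for
  row digit \<open>x\<close> and node position \<open>w\<close>. The value at \<open>x = w\<close>
  is 0 because the diagonal entry then belongs to the third case of the matrix, which is accounted
  for separately.\<close>

definition eps :: "nat \<Rightarrow> nat \<Rightarrow> 'a" where
  "eps x w = (if x < w then 1 else if w < x then \<gamma> else 0)"

text \<open>Collects all that is multiplied by \<open>lam j ^ t\<close> in row \<open>a\<close>.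
  Besides the symbol of \<open>j\<close> this is a symbol of node \<open>(v, x)\<close>, the one
  node of the group whose matrix has the third form in row \<open>a\<close>. For
  \<open>x = w\<close> and \<open>a < l\<close> only \<open>c j a\<close> remains. The array
  \<open>c\<close> holds bare scalars, so differences of codewords fit as well.\<close>

definition coupled :: "(nat \<Rightarrow> nat \<Rightarrow> 'a) \<Rightarrow> nat \<Rightarrow> nat \<Rightarrow> 'a" where
  "coupled c a j =
     (let v = group_of s j; w = pos_of s j; x = dig a v
      in eps x w * c j a + c (node s v x) (rep a v w))"

lemma A_mat_carrier [simp]: "A_mat s m \<gamma> lam t i \<in> carrier_mat l l"
  by (simp add: A_mat_def Let_def)

text \<open>Row \<open>a\<close> is either diagonal or supported on the \<open>s\<close> columns
  \<open>rep a v w\<close>; \<open>eps\<close> vanishes exactly in the second case, so one formula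
  covers both.\<close>

lemma A_mat_mult_vec:
  assumes i: "i \<in> {1..n}" and x: "x \<in> carrier_vec l" and a: "a < l" and v: "v = group_of s i"
  shows "(A_mat s m \<gamma> lam t i *\<^sub>v x) $ a =
    eps (dig a v) (pos_of s i) * lam i ^ t * x $ a +
    (if pos_of s i = dig a v then \<Sum>w<s. lam (node s v w) ^ t * x $ rep a v w else 0)"
proof -
  define u where "u = pos_of s i"
  have vm: "v \<in> {1..m}" using group_of_in[OF i] v by simp
  define M where "M b = (if dig a v < u \<and> b = a then lam i ^ t
        else if dig a v > u \<and> b = a then \<gamma> * lam i ^ t
        else if dig a v = u \<and> (\<exists>w<s. b = rep a v w)
          then lam ((v - 1) * s + dig b v + 1) ^ t
        else 0)" for b
  have "A_mat s m \<gamma> lam t i $$ (a, b) = M b" if "b < l" for b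
    using that a by (auto simp: A_mat_def Let_def M_def v u_def group_of_def pos_of_def)
  then have "(A_mat s m \<gamma> lam t i *\<^sub>v x) $ a = (\<Sum>b<l. M b * x $ b)"
    using x a A_mat_carrier[of t i] by (simp add: scalar_prod_def atLeast0LessThan del: A_mat_carrier)
  also have "\<dots> = eps (dig a v) u * lam i ^ t * x $ a +
    (if u = dig a v then \<Sum>w<s. lam (node s v w) ^ t * x $ rep a v w else 0)"
  proof (cases "dig a v = u")
    case True
    have "(\<Sum>b<l. M b * x $ b) = (\<Sum>b\<in>rep a v ` {..<s}. M b * x $ b)"
      by (rule sum.mono_neutral_right) (use True in \<open>auto simp: replace_digit_lt M_def\<close>)
    also have "\<dots> = (\<Sum>w<s. M (rep a v w) * x $ rep a v w)"
    proof (rule sum.reindex_cong[OF _ refl refl])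
      show "inj_on (rep a v) {..<s}"
        using digit_replace_digit[OF _ vm, of _ s a v] by (metis inj_onI lessThan_iff)
    qed
    also have "\<dots> = (\<Sum>w<s. lam (node s v w) ^ t * x $ rep a v w)"
      by (rule sum.cong[OF refl])
         (use True vm in \<open>auto simp: M_def digit_replace_digit node_def\<close>)
    finally show ?thesis using True by (simp add: eps_def)
  next
    case False
    then have "(\<Sum>b<l. M b * x $ b) = (\<Sum>b\<in>{a}. M b * x $ b)"
      using a by (intro sum.mono_neutral_right) (auto simp: M_def)
    then show ?thesis using False by (auto simp: M_def eps_def)
  qed
  finally show ?thesis by (simp add: u_def)
qed

text \<open>Within a group, node \<open>(v, x)\<close> with \<open>x = dig a v\<close> contributes
  \<open>s\<close> symbols, each weighted by the \<open>lam\<close> of some node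
  \<open>(v, w)\<close>. Crediting each symbol to that node turns the matrix products into a
  Vandermonde sum.\<close>

lemma parity_check_row:
  assumes C: "C \<in> {1..n} \<rightarrow> carrier_vec l" and a: "a < l"
  shows "(\<Sum>i\<in>{1..n}. (A_mat s m \<gamma> lam t i *\<^sub>v C i) $ a) =
    (\<Sum>j\<in>{1..n}. lam j ^ t * coupled (\<lambda>i a. C i $ a) a j)"
  unfolding sum_nodes[OF s_pos]
proof (rule sum.cong[OF refl])
  fix v assume v: "v \<in> {1..m}"
  define x where "x = dig a v"
  have x: "x < s" using s_pos by (simp add: x_def)
  have "(\<Sum>u<s. (A_mat s m \<gamma> lam t (node s v u) *\<^sub>v C (node s v u)) $ a) =
    (\<Sum>u<s. eps x u * lam (node s v u) ^ t * C (node s v u) $ a +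
      (if u = x then \<Sum>w<s. lam (node s v w) ^ t * C (node s v u) $ rep a v w else 0))"
  proof (rule sum.cong[OF refl])
    fix u assume "u \<in> {..<s}"
    then have u: "u < s" by simp
    show "(A_mat s m \<gamma> lam t (node s v u) *\<^sub>v C (node s v u)) $ a =
      eps x u * lam (node s v u) ^ t * C (node s v u) $ a +
      (if u = x then \<Sum>w<s. lam (node s v w) ^ t * C (node s v u) $ rep a v w else 0)"
      using A_mat_mult_vec[OF node_in[OF v u] funcset_mem[OF C node_in[OF v u]] a refl, of t] v u
      by (simp add: x_def)
  qed
  \<comment> \<open>The inner sum survives for \<open>u = x\<close> only.\<close>
  also have "\<dots> = (\<Sum>u<s. eps x u * lam (node s v u) ^ t * C (node s v u) $ a) +
      (\<Sum>w<s. lam (node s v w) ^ t * C (node s v x) $ rep a v w)"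
    using x by (simp add: sum.distrib)
  also have "\<dots> = (\<Sum>u<s. lam (node s v u) ^ t * coupled (\<lambda>i a. C i $ a) a (node s v u))"
    unfolding sum.distrib[symmetric]
    by (rule sum.cong[OF refl])
       (use v in \<open>auto simp: coupled_def Let_def x_def algebra_simps\<close>)
  finally show "(\<Sum>u<s. (A_mat s m \<gamma> lam t (node s v u) *\<^sub>v C (node s v u)) $ a) =
      (\<Sum>u<s. lam (node s v u) ^ t * coupled (\<lambda>i a. C i $ a) a (node s v u))" .
qed

text \<open>From here on, membership in the code is used in this row-wise form, without the
  matrices.\<close>

lemma code_iff:
  "C \<in> code \<longleftrightarrow> C \<in> {1..n} \<rightarrow>\<^sub>E carrier_vec l \<and>
     (\<forall>a<l. \<forall>t<r. (\<Sum>j\<in>{1..n}. lam j ^ t * coupled (\<lambda>i a. C i $ a) a j) = 0)"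
proof (cases "C \<in> {1..n} \<rightarrow>\<^sub>E carrier_vec l")
  case True
  then have C: "C \<in> {1..n} \<rightarrow> carrier_vec l" by auto
  have AC: "(\<lambda>i. A_mat s m \<gamma> lam t i *\<^sub>v C i) \<in> {1..n} \<rightarrow> carrier_vec l" for t
    using C by (auto intro!: mult_mat_vec_carrier A_mat_carrier)
  have "finsum_vec TYPE('a) l (\<lambda>i. A_mat s m \<gamma> lam t i *\<^sub>v C i) {1..n} = 0\<^sub>v l \<longleftrightarrow>
    (\<forall>a<l. (\<Sum>j\<in>{1..n}. lam j ^ t * coupled (\<lambda>i a. C i $ a) a j) = 0)" (is "?S = _ \<longleftrightarrow> ?R") for t
  proof -
    have S: "?S \<in> carrier_vec l" by (rule finsum_vec_closed[OF AC])
    have "?S = 0\<^sub>v l \<longleftrightarrow> (\<forall>a<l. ?S $ a = 0)"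
      using S by (auto intro!: eq_vecI)
    also have "\<dots> \<longleftrightarrow> ?R"
      by (simp only: index_finsum_vec[OF finite_atLeastAtMost _ AC] parity_check_row[OF C] cong: imp_cong)
    finally show ?thesis .
  qed
  with True show ?thesis unfolding the_code_def by blast
qed (auto simp: the_code_def)

text \<open>The row set \<open>B\<close> is closed under changing digits in the groups of
  \<open>V\<close>, so that the lemma serves twice: with all groups and rows for the MDS property,
  and with the failed group removed and its digit fixed for repair. Groups outside \<open>V\<close>
  lie wholly in \<open>E\<close>; their coupled symbols are among the at most \<open>r\<close>
  unknowns of a row and are never decoupled.\<close>

lemma kernel_zero:
  fixes c :: "nat \<Rightarrow> nat \<Rightarrow> 'a"
  assumes V: "V \<subseteq> {1..m}" and E: "E \<subseteq> {1..n}" "card E \<le> r"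
    and B: "\<And>a. a \<in> B \<Longrightarrow> a < l" "\<And>a v w. a \<in> B \<Longrightarrow> v \<in> V \<Longrightarrow> w < s \<Longrightarrow> rep a v w \<in> B"
    and eqs: "\<And>a t. a \<in> B \<Longrightarrow> t < r \<Longrightarrow> (\<Sum>j\<in>{1..n}. lam j ^ t * coupled c a j) = 0"
    and outV: "\<And>j. j \<in> {1..n} \<Longrightarrow> group_of s j \<notin> V \<Longrightarrow> j \<in> E"
    and zero: "\<And>j a. j \<in> {1..n} - E \<Longrightarrow> a \<in> B \<Longrightarrow> c j a = 0"
    and aj: "a \<in> B" "j \<in> {1..n}"
  shows "coupled c a j = 0" and "group_of s j \<in> V \<Longrightarrow> c j a = 0"
proof -
  define W where "W a = {v \<in> V. node s v (dig a v) \<in> E}" for a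
  have finV: "finite V" using V finite_subset by blast
  then have finW: "finite (W a)" for a by (simp add: W_def)
  have "coupled c a j = 0 \<and> (group_of s j \<in> V \<longrightarrow> c j a = 0)"
    using aj
  proof (induction "card (W a)" arbitrary: a j rule: less_induct)
    case less
    \<comment> \<open>Proved for all rows \<open>b\<close> with the same \<open>W\<close>, because
      decoupling row \<open>a\<close> below also needs the partner row
      \<open>rep a v w\<close>.\<close>
    have cz: "coupled c b i = 0" if b: "b \<in> B" "W b = W a" and i: "i \<in> {1..n}" for b i
    proof (rule vandermonde_kernel[where A = "{1..n}" and E = E and lam = lam and r = r])
      fix i assume i: "i \<in> {1..n} - E"
      define v w x where "v = group_of s i" and "w = pos_of s i" and "x = dig b v"
      have vV: "v \<in> V" using outV i v_def by blast
      have x: "x < s" and w: "w < s" using s_pos by (simp_all add: x_def w_def)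
      have v: "v \<in> {1..m}" using vV V by auto
      have i': "i = node s v w" using i by (simp add: v_def w_def)
      have bw: "rep b v w \<in> B" using B(2) b vV w by blast
      have "c (node s v x) (rep b v w) = 0"
      proof (cases "node s v x \<in> E")
        case True
        \<comment> \<open>Digit \<open>v\<close> of the new row points to \<open>i\<close>, which is
          outside \<open>E\<close>. So \<open>v\<close> leaves \<open>W\<close>, and the induction
          hypothesis kills the partner symbol.\<close>
        have "W (rep b v w) \<subseteq> W b - {v}"
        proof
          fix v' assume v': "v' \<in> W (rep b v w)"
          then have "v' \<in> {1..m}" using V by (auto simp: W_def)
          with v' i i' digit_replace_digit[OF w, of v' m b v] show "v' \<in> W b - {v}"
            by (auto simp: W_def split: if_splits)
        qed
        moreover have "v \<in> W b" using True vV by (simp add: W_def x_def)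
        ultimately have "card (W (rep b v w)) < card (W a)"
          unfolding b(2)[symmetric] by (intro psubset_card_mono finW) auto
        with less.hyps[OF this bw node_in[OF v x]] show ?thesis
          using vV v x by simp
      qed (use zero node_in[OF v x] bw in auto)
      moreover have "c i b = 0" using zero i b by blast
      ultimately show "coupled c b i = 0"
        by (simp add: coupled_def v_def w_def x_def Let_def)
    qed (use E b i eqs inj_lam in \<open>auto intro: inj_on_subset\<close>)
    have "c j a = 0" if vV: "group_of s j \<in> V"
    proof (cases "j \<in> E")
      case True
      define v w x where "v = group_of s j" and "w = pos_of s j" and "x = dig a v"
      have x: "x < s" and w: "w < s" using s_pos by (simp_all add: x_def w_def)
      have v: "v \<in> {1..m}" "v \<in> V" using vV V by (auto simp: v_def)
      have j: "j = node s v w" using less.prems by (simp add: v_def w_def)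
      have aw: "rep a v w \<in> B" using B(2) less.prems v w by blast
      have cj: "eps x w * c j a + c (node s v x) (rep a v w) = 0"
        using cz[OF less.prems(1) refl less.prems(2)]
        by (simp add: coupled_def v_def w_def x_def Let_def)
      show ?thesis
      proof (cases "x = w")
        case True
        then show ?thesis
          using cj j B(1) less.prems by (simp add: eps_def x_def[symmetric] replace_digit_same)
      next
        case xw: False
        show ?thesis
        proof (cases "node s v x \<in> E")
          case nE: True
          \<comment> \<open>Both \<open>(v, x)\<close> and \<open>j = (v, w)\<close> lie in
            \<open>E\<close>, so exchanging digit \<open>x\<close> for \<open>w\<close> does not
            change \<open>W\<close>.\<close>
          have "W (rep a v w) = W a"
          proof -
            have "node s v' (dig (rep a v w) v') \<in> E \<longleftrightarrow> node s v' (dig a v') \<in> E" if "v' \<in> V" for v'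
              using digit_replace_digit[OF w, of v' m a v] that V nE j True
              by (cases "v' = v") (auto simp: x_def)
            then show ?thesis by (auto simp: W_def)
          qed
          moreover have "rep (rep a v w) v x = a"
            using v w x s_pos less.prems B(1) by (simp add: replace_digit_twice replace_digit_same x_def)
          moreover have "dig (rep a v w) v = w"
            using v w by (simp add: digit_replace_digit)
          ultimately have cx: "eps w x * c (node s v x) (rep a v w) + c j a = 0"
            using cz[OF aw _ node_in[OF v(1) x]] v(1) x j by (simp add: coupled_def Let_def)
          \<comment> \<open>Elimination of the partner symbol from the pair of equations. The
            coefficient is their determinant \<open>\<gamma> - 1\<close>, as one \<open>eps\<close>
            is 1 and the other \<open>\<gamma>\<close>.\<close>
          have "(eps x w * eps w x - 1) * c j a =
              eps w x * (eps x w * c j a + c (node s v x) (rep a v w)) -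
              (eps w x * c (node s v x) (rep a v w) + c j a)"
            by (simp add: algebra_simps)
          then have "(eps x w * eps w x - 1) * c j a = 0"
            unfolding cj cx by simp
          moreover have "eps x w * eps w x = \<gamma>" using xw by (auto simp: eps_def)
          ultimately show ?thesis using gamma by simp
        next
          case False
          then have "c (node s v x) (rep a v w) = 0" using zero node_in[OF v(1) x] aw by blast
          with cj xw gamma show ?thesis by (auto simp: eps_def split: if_splits)
        qed
      qed
    qed (use zero less.prems in blast)
    with cz less.prems show ?case by blast
  qed
  then show "coupled c a j = 0" and "group_of s j \<in> V \<Longrightarrow> c j a = 0" by auto
qed

section \<open>Codewords determined by some of their symbols\<close>

abbreviation "words \<equiv> {1..n} \<rightarrow>\<^sub>E (carrier_vec l :: 'a vec set)"

lemma code_carrier: "C \<in> code \<Longrightarrow> j \<in> {1..n} \<Longrightarrow> C j \<in> carrier_vec l"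
  by (auto simp: code_iff)

lemma coupled_diff:
  "coupled (\<lambda>i a. c i a - d i a) a j = coupled c a j - coupled d a j"
  by (simp add: coupled_def Let_def algebra_simps)

lemma code_diff:
  assumes "C \<in> code" "D \<in> code" "a < l" "t < r"
  shows "(\<Sum>j\<in>{1..n}. lam j ^ t * coupled (\<lambda>i a. C i $ a - D i $ a) a j) = 0"
  using assms by (simp add: code_iff coupled_diff right_diff_distrib sum_subtractf)

text \<open>The difference of two such codewords vanishes outside at most \<open>r\<close> nodes, so
  \<open>kernel_zero\<close> applies with all groups and all rows.\<close>

lemma code_eqI:
  assumes S: "S \<subseteq> {1..n}" "k \<le> card S" and C: "C \<in> code" "D \<in> code"
    and eq: "\<And>j. j \<in> S \<Longrightarrow> C j = D j"
  shows "C = D"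
proof (rule PiE_ext)
  show "C \<in> words" "D \<in> words" using C by (auto simp: code_iff)
  fix j assume j: "j \<in> {1..n}"
  define c where "c = (\<lambda>i a. C i $ a - D i $ a)"
  have card: "card ({1..n} - S) \<le> r"
    using S finite_subset[OF S(1)] by (simp add: card_Diff_subset)
  have "c j a = 0" if "a < l" for a
  proof (rule kernel_zero(2)[where V = "{1..m}" and E = "{1..n} - S" and B = "{..<l}" and c = c])
    show "(\<Sum>j\<in>{1..n}. lam j ^ t * coupled c a j) = 0" if "a \<in> {..<l}" "t < r" for a t
      unfolding c_def using code_diff[OF C] that by simp
    show "group_of s j \<in> {1..m}" by (rule group_of_in[OF j])
    show "i \<in> {1..n} - S" if "i \<in> {1..n}" "group_of s i \<notin> {1..m}" for i
      using group_of_in[OF that(1)] that(2) by simp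
    show "rep a v w \<in> {..<l}" if "w < s" for a v w
      using that by (simp add: replace_digit_lt)
  qed (use that j eq card in \<open>auto simp: c_def\<close>)
  then show "C j = D j"
    using code_carrier[OF C(1) j] code_carrier[OF C(2) j] by (auto simp: c_def)
qed

text \<open>\<open>kernel_zero\<close> with the failed group left out of \<open>V\<close> makes the
  coupled symbols vanish in the accessed rows. Within the failed group these consist of the
  coordinates of node \<open>i\<close>, up to helper symbols in the same rows.\<close>

lemma repair_unique:
  assumes i: "i \<in> {1..n}" and R: "R \<subseteq> {1..n} - {i}"
    and G: "G = {j \<in> {1..n}. group_of s j = group_of s i}" "G - {i} \<subseteq> R" "k \<le> card (R - G)"
    and C: "C \<in> code" "D \<in> code"
    and eq: "\<And>j a. j \<in> R \<Longrightarrow> a < l \<Longrightarrow> dig a (group_of s i) = pos_of s i \<Longrightarrow> C j $ a = D j $ a"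
  shows "C i = D i"
proof -
  define v u where "v = group_of s i" and "u = pos_of s i"
  have v: "v \<in> {1..m}" using group_of_in[OF i] by (simp add: v_def)
  have u: "u < s" using s_pos by (simp add: u_def)
  have iv: "node s v u = i" using i by (simp add: v_def u_def)
  define c where "c = (\<lambda>i a. C i $ a - D i $ a)"
  define B where "B = {a. a < l \<and> dig a v = u}"
  \<comment> \<open>The other nodes of the group count as unknown although they are helpers: their
    coupling with \<open>i\<close> leads out of the rows in \<open>B\<close>.\<close>
  define E where "E = {1..n} - (R - G)"
  have "card E \<le> r"
    unfolding E_def using G(3) R by (subst card_Diff_subset) (auto intro: finite_subset)
  have coupled0: "coupled c a j = 0" if "a \<in> B" "j \<in> {1..n}" for a j
  proof (rule kernel_zero(1)[where V = "{1..m} - {v}" and E = E and B = B and c = c])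
    show "(\<Sum>j\<in>{1..n}. lam j ^ t * coupled c a j) = 0" if "a \<in> B" "t < r" for a t
      unfolding c_def using code_diff[OF C] that by (simp add: B_def)
    show "j \<in> E" if "j \<in> {1..n}" "group_of s j \<notin> {1..m} - {v}" for j
      using group_of_in[OF that(1)] that by (auto simp: E_def G v_def)
    show "rep a v' w \<in> B" if "a \<in> B" "v' \<in> {1..m} - {v}" "w < s" for a v' w
      using that v by (auto simp: B_def replace_digit_lt digit_replace_digit)
    show "c j a = 0" if "j \<in> {1..n} - E" "a \<in> B" for j a
      using that eq by (auto simp: E_def B_def c_def v_def u_def)
  qed (use that \<open>card E \<le> r\<close> in \<open>auto simp: B_def E_def\<close>)
  have "c i b = 0" if b: "b < l" for b
  proof -
    \<comment> \<open>As \<open>rep a v w = b\<close>, the coupled symbol of node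
      \<open>(v, w)\<close> in the accessed row \<open>a\<close> contains
      \<open>c i b\<close>.\<close>
    define w a where "w = dig b v" and "a = rep b v u"
    have w: "w < s" using s_pos by (simp add: w_def)
    have a: "a \<in> B" using u v by (simp add: a_def B_def replace_digit_lt digit_replace_digit)
    have "eps u w * c (node s v w) a = 0"
    proof (cases "w = u")
      case False
      have "node s v w \<in> R"
      proof -
        have "node s v w \<in> G"
          using node_in[OF v w] v w by (simp add: G(1) v_def)
        moreover have "node s v w \<noteq> i"
          using False pos_of_node[OF w, of v] by (auto simp: u_def)
        ultimately show ?thesis using G(2) by blast
      qed
      then show ?thesis using a eq by (auto simp: B_def c_def v_def u_def)
    qed (simp add: eps_def)
    moreover have "rep a v w = b" "dig a v = u"
      using s_pos u v w b a by (auto simp: a_def replace_digit_twice replace_digit_same w_def B_def)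
    ultimately show ?thesis
      using coupled0[OF a node_in[OF v w]] v w iv by (auto simp: coupled_def Let_def)
  qed
  then show ?thesis
    using code_carrier[OF C(1) i] code_carrier[OF C(2) i] by (auto simp: c_def)
qed

section \<open>The size of the code and the MDS property\<close>

lemma card_words: "finite A \<Longrightarrow> card (A \<rightarrow>\<^sub>E (carrier_vec l :: 'a vec set)) = CARD('a) ^ (card A * l)"
  by (simp add: card_PiE card_carrier_vec power_mult[symmetric] mult.commute)

lemma finite_words: "finite A \<Longrightarrow> finite (A \<rightarrow>\<^sub>E (carrier_vec l :: 'a vec set))"
  by (rule finite_PiE) auto

lemma finite_code: "finite code"
proof (rule finite_subset)
  show "code \<subseteq> words" using code_iff by blast
qed (simp add: finite_words)

text \<open>One injection with two uses: it bounds the size of the code from above, and for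
  \<open>card S = k\<close> a count makes it onto.\<close>

lemma restrict_code:
  assumes S: "S \<subseteq> {1..n}" "k \<le> card S"
  shows "inj_on (\<lambda>C. restrict C S) code"
    and "(\<lambda>C. restrict C S) ` code \<subseteq> S \<rightarrow>\<^sub>E carrier_vec l"
proof -
  show "inj_on (\<lambda>C. restrict C S) code"
  proof (rule inj_onI)
    fix C D assume CD: "C \<in> code" "D \<in> code" "restrict C S = restrict D S"
    have "C j = D j" if "j \<in> S" for j
      using fun_cong[OF CD(3), of j] that by simp
    with CD show "C = D" by (intro code_eqI[OF S])
  qed
  show "(\<lambda>C. restrict C S) ` code \<subseteq> S \<rightarrow>\<^sub>E carrier_vec l"
  proof (rule image_subsetI)
    fix C assume C: "C \<in> code"
    show "restrict C S \<in> S \<rightarrow>\<^sub>E carrier_vec l"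
      using code_carrier[OF C] S(1) by (intro restrict_PiE_iff[THEN iffD2]) blast
  qed
qed

text \<open>The upper bound restricts codewords to \<open>k\<close> nodes. For the lower bound, the
  syndrome map \<open>syn\<close> takes at most \<open>CARD('a) ^ (r * l)\<close> values, and none
  of its fibres is larger than the code.\<close>

lemma card_code: "card code = CARD('a) ^ (k * l)"
proof (rule antisym)
  have "card code \<le> card ({1..k} \<rightarrow>\<^sub>E (carrier_vec l :: 'a vec set))"
    by (rule card_inj_on_le[OF restrict_code]) (auto intro: finite_words)
  then show "card code \<le> CARD('a) ^ (k * l)" by (simp add: card_words)
  define syn where "syn C = (\<lambda>(a, t)\<in>{..<l} \<times> {..<r}.
    \<Sum>j\<in>{1..n}. lam j ^ t * coupled (\<lambda>i a. C i $ a) a j)" for C :: "nat \<Rightarrow> 'a vec"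
  define Y where "Y = ({..<l} \<times> {..<r}) \<rightarrow>\<^sub>E (UNIV :: 'a set)"
  have finY: "finite Y" by (auto simp: Y_def intro: finite_PiE)
  have cardY: "card Y = CARD('a) ^ (r * l)"
    by (simp add: Y_def card_PiE mult.commute)
  have fib: "card {C \<in> words. syn C = y} \<le> card code" for y
  proof (cases "{C \<in> words. syn C = y} = {}")
    case False
    then obtain D where D: "D \<in> words" "syn D = y" by blast
    \<comment> \<open>Subtracting a fixed element \<open>D\<close> of the fibre moves the fibre
      injectively into the code.\<close>
    let ?f = "\<lambda>C. \<lambda>i\<in>{1..n}. C i - D i"
    show ?thesis
    proof (rule card_inj_on_le[where f = ?f])
      show "inj_on ?f {C \<in> words. syn C = y}"
      proof (rule inj_onI)
        fix C C' assume *: "C \<in> {C \<in> words. syn C = y}" "C' \<in> {C \<in> words. syn C = y}" "?f C = ?f C'"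
        show "C = C'"
        proof (rule PiE_ext)
          show "C \<in> words" "C' \<in> words" using * by auto
          fix i assume i: "i \<in> {1..n}"
          have car: "C i \<in> carrier_vec l" "C' i \<in> carrier_vec l" "D i \<in> carrier_vec l"
            using PiE_mem[OF _ i] * D by blast+
          have "C i - D i = C' i - D i" using fun_cong[OF *(3), of i] i by simp
          then have "(C i - D i) $ a = (C' i - D i) $ a" for a by simp
          then have "C i $ a = C' i $ a" if "a < l" for a
            using car that by (metis carrier_vecD diff_add_cancel index_minus_vec(1))
          then show "C i = C' i" using car by auto
        qed
      qed
      show "?f ` {C \<in> words. syn C = y} \<subseteq> code"
      proof (rule image_subsetI)
        fix C assume "C \<in> {C \<in> words. syn C = y}"
        then have C: "C \<in> words" "syn C = syn D" using D by auto
        have sub: "?f C i $ a = C i $ a - D i $ a" if "i \<in> {1..n}" "a < l" for i a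
          using PiE_mem[OF C(1) that(1)] PiE_mem[OF D(1) that(1)] that by simp
        show "?f C \<in> code"
          unfolding code_iff
        proof (intro conjI allI impI)
          have "C i - D i \<in> carrier_vec l" if "i \<in> {1..n}" for i
            using PiE_mem[OF C(1) that] PiE_mem[OF D(1) that] by simp
          then show "?f C \<in> words"
            by (intro restrict_PiE_iff[THEN iffD2]) blast
        next
          fix a t assume at: "a < l" "t < r"
          \<comment> \<open>\<open>coupled\<close> reads only nodes in \<open>{1..n}\<close> and
            rows below \<open>l\<close>, where the restricted vector difference is the entrywise
            one.\<close>
          have "(\<Sum>j\<in>{1..n}. lam j ^ t * coupled (\<lambda>i a. ?f C i $ a) a j) =
            (\<Sum>j\<in>{1..n}. lam j ^ t * coupled (\<lambda>i a. C i $ a - D i $ a) a j)"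
          proof (rule sum.cong[OF refl])
            fix j assume j: "j \<in> {1..n}"
            have "node s (group_of s j) x \<in> {1..n}" if "x < s" for x
              using node_in[OF group_of_in[OF j] that] .
            then show "lam j ^ t * coupled (\<lambda>i a. ?f C i $ a) a j =
                lam j ^ t * coupled (\<lambda>i a. C i $ a - D i $ a) a j"
              using j at sub s_pos by (simp add: coupled_def Let_def replace_digit_lt del: restrict_apply)
          qed
          also have "\<dots> = syn C (a, t) - syn D (a, t)"
            using at by (simp add: syn_def coupled_diff right_diff_distrib sum_subtractf)
          finally show "(\<Sum>j\<in>{1..n}. lam j ^ t * coupled (\<lambda>i a. ?f C i $ a) a j) = 0"
            using C(2) by simp
        qed
      qed
    qed (rule finite_code)
  next
    case True
    show ?thesis unfolding True by simp
  qed
  have "CARD('a) ^ (n * l) = card words" by (simp add: card_words)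
  also have "words = (\<Union>y\<in>Y. {C \<in> words. syn C = y})"
  proof -
    have "syn C \<in> Y" for C by (auto simp: syn_def Y_def)
    then show ?thesis by blast
  qed
  also have "card \<dots> \<le> (\<Sum>y\<in>Y. card {C \<in> words. syn C = y})"
    by (rule card_UN_le[OF finY])
  also have "\<dots> \<le> (\<Sum>y\<in>Y. card code)"
    by (intro sum_mono fib)
  also have "\<dots> = CARD('a) ^ (r * l) * card code" by (simp add: cardY)
  finally have "CARD('a) ^ (n * l) \<le> CARD('a) ^ (r * l) * card code" .
  moreover have "CARD('a) ^ (n * l) = CARD('a) ^ (r * l) * CARD('a) ^ (k * l)"
  proof -
    have "r + k = n" using r_le by simp
    then have "n * l = r * l + k * l" by (metis distrib_right)
    then show ?thesis by (simp only: power_add)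
  qed
  ultimately show "CARD('a) ^ (k * l) \<le> card code" by simp
qed

lemma mds_code: "mds_array_code n k l code"
  unfolding mds_array_code_def array_code_def
proof (intro conjI allI impI ballI)
  show "code \<subseteq> words" using code_iff by blast
  show "card code = CARD('a) ^ (k * l)" by (rule card_code)
  fix S C D j
  assume S: "S \<subseteq> {1..n}" "card S = k" and "C \<in> code" "D \<in> code" "\<forall>j\<in>S. C j = D j"
  with code_eqI[OF S(1), of C D] show "C j = D j" by simp
qed

section \<open>Bounds on the number of accessed symbols\<close>

lemma code_extend:
  assumes S: "S \<subseteq> {1..n}" "card S = k" and y: "y \<in> S \<rightarrow> carrier_vec l"
  shows "\<exists>C\<in>code. \<forall>j\<in>S. C j = y j"
proof -
  have finS: "finite S" by (rule finite_subset[OF S(1)]) simp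
  \<comment> \<open>Restriction is injective between finite sets of the same size
    \<open>CARD('a) ^ (k * l)\<close>, hence onto.\<close>
  have "(\<lambda>C. restrict C S) ` code = S \<rightarrow>\<^sub>E carrier_vec l"
    using restrict_code[OF S(1)] S finS
    by (intro card_subset_eq finite_words) (auto simp: card_image card_code card_words)
  moreover have "restrict y S \<in> S \<rightarrow>\<^sub>E carrier_vec l" using y by auto
  ultimately obtain C where "C \<in> code" "restrict y S = restrict C S" by blast
  then show ?thesis by (metis restrict_apply')
qed

text \<open>For \<open>s\<close> helpers \<open>U\<close>, the other \<open>k - 1\<close> helpers
  and node \<open>i\<close> form \<open>k\<close> nodes with freely prescribable contents. With
  those helpers zero, the symbols accessed in \<open>U\<close> must tell apart all
  \<open>CARD('a) ^ l\<close> contents of node \<open>i\<close>. Counting works for arbitrary, also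
  nonlinear, \<open>f\<close> and \<open>g\<close>.\<close>

lemma access_lower_bound:
  assumes i: "i \<in> {1..n}" and R: "R \<subseteq> {1..n} - {i}" "card R = s + k - 1" and k: "k > 0"
    and rep: "repairable_by_access l code i R \<omega>"
  shows "card R * l \<le> s * \<omega>"
proof -
  obtain \<beta> \<omega>' :: "nat \<Rightarrow> nat" and f :: "nat \<Rightarrow> 'a vec \<Rightarrow> 'a vec" and g where sum: "(\<Sum>j\<in>R. \<omega>' j) = \<omega>"
    and f: "\<forall>j\<in>R. f j \<in> carrier_vec l \<rightarrow> carrier_vec (\<beta> j) \<and>
      (\<exists>S \<subseteq> {..<l}. card S = \<omega>' j \<and> depends_on_coords l S (f j))"
    and g': "\<forall>C\<in>code. C i = g (\<lambda>j\<in>R. f j (C j))"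
    using rep unfolding repairable_by_access_def by (elim exE conjE) (rule that)
  note g = bspec[OF g']
  have "\<forall>j\<in>R. \<exists>S. S \<subseteq> {..<l} \<and> card S = \<omega>' j \<and> depends_on_coords l S (f j)"
    using f by blast
  from bchoice[OF this] obtain S
    where S: "\<And>j. j \<in> R \<Longrightarrow> S j \<subseteq> {..<l} \<and> card (S j) = \<omega>' j \<and> depends_on_coords l (S j) (f j)"
    by blast
  have finR: "finite R" by (rule finite_subset[OF R(1)]) simp
  have "l \<le> sum \<omega>' U" if U: "U \<subseteq> R" "card U = s" for U
  proof -
    have finU: "finite U" by (rule finite_subset[OF U(1) finR])
    define T where "T = R - U"
    have T: "T \<subseteq> R" "i \<notin> T" "finite T" "R = T \<union> U" using R finR U by (auto simp: T_def)
    have "card T = k - 1" using U R finU by (simp add: T_def card_Diff_subset)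
    then have "card (insert i T) = k" using T k by simp
    moreover have "insert i T \<subseteq> {1..n}" using i R T by auto
    ultimately have "\<exists>C\<in>code. \<forall>j\<in>insert i T. C j = (if j = i then x else 0\<^sub>v l)"
      if "x \<in> carrier_vec l" for x :: "'a vec"
      using that by (intro code_extend) auto
    then have "\<exists>C. C \<in> code \<and> C i = x \<and> (\<forall>j\<in>T. C j = 0\<^sub>v l)"
      if "x \<in> carrier_vec l" for x :: "'a vec"
      using that T(2) by (metis insertCI)
    then have "\<forall>x\<in>carrier_vec l. \<exists>C. C \<in> code \<and> C i = x \<and> (\<forall>j\<in>T. C j = 0\<^sub>v l)"
      by blast
    from bchoice[OF this] obtain h where "\<forall>x\<in>carrier_vec l.
      h x \<in> code \<and> h x i = x \<and> (\<forall>j\<in>T. h x j = 0\<^sub>v l)" by blast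
    then have h: "h x \<in> code" and hi: "h x i = x" and hT: "\<And>j. j \<in> T \<Longrightarrow> h x j = 0\<^sub>v l"
      if "x \<in> carrier_vec l" for x
      using that by blast+
    \<comment> \<open>Only the accessed coordinates of the helpers in \<open>U\<close> are recorded;
      they determine what \<open>f\<close> delivers.\<close>
    define acc where "acc x = (\<lambda>j\<in>U. \<lambda>a\<in>S j. h x j $ a)" for x
    let ?Z = "\<Pi>\<^sub>E j\<in>U. S j \<rightarrow>\<^sub>E (UNIV :: 'a set)"
    have finS: "finite (S j)" if "j \<in> U" for j
      using S[of j] U(1) that by (blast intro: finite_subset[OF _ finite_lessThan])
    have "inj_on acc (carrier_vec l)"
    proof (rule inj_onI)
      fix x y :: "'a vec" assume xy: "x \<in> carrier_vec l" "y \<in> carrier_vec l" "acc x = acc y"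
      have "f j (h x j) = f j (h y j)" if j: "j \<in> R" for j
      proof (cases "j \<in> U")
        case True
        have "h x j $ a = h y j $ a" if "a \<in> S j" for a
          using fun_cong[OF fun_cong[OF xy(3), of j], of a] True that by (simp add: acc_def)
        moreover have "j \<in> {1..n}" using j R by auto
        ultimately show ?thesis
          using S[OF j] code_carrier[OF h[OF xy(1)]] code_carrier[OF h[OF xy(2)]]
          by (intro depends_on_coordsD[of l "S j" "f j"]) auto
      next
        case False
        then show ?thesis using hT[OF xy(1)] hT[OF xy(2)] T(4) j by simp
      qed
      then have "(\<lambda>j\<in>R. f j (h x j)) = (\<lambda>j\<in>R. f j (h y j))" by (rule restrict_ext)
      then have "h x i = h y i" using g[OF h[OF xy(1)]] g[OF h[OF xy(2)]] by simp
      then show "x = y" using hi xy by simp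
    qed
    moreover have "acc ` carrier_vec l \<subseteq> ?Z"
      unfolding acc_def by (intro image_subsetI) simp
    moreover have "finite ?Z" using finU finS by (intro finite_PiE) auto
    ultimately have "card (carrier_vec l :: 'a vec set) \<le> card ?Z" by (rule card_inj_on_le)
    also have "card ?Z = (\<Prod>j\<in>U. CARD('a) ^ \<omega>' j)"
    proof -
      have "card (S j) = \<omega>' j" if "j \<in> U" for j using S[of j] U that by blast
      then show ?thesis using finU finS by (simp add: card_PiE)
    qed
    finally have "CARD('a) ^ l \<le> CARD('a) ^ sum \<omega>' U"
      unfolding card_carrier_vec power_sum .
    moreover have "CARD('a) > 1"
      using card_mono[of UNIV "{0, 1 :: 'a}"] by simp
    ultimately show ?thesis by (intro power_le_imp_le_exp)
  qed
  moreover have "s \<le> card R" using R(2) k by linarith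
  ultimately have "card R * l \<le> s * sum \<omega>' R"
    by (intro average_bound[OF s_pos finR])
  then show ?thesis by (simp add: sum)
qed

text \<open>Every helper reveals its coordinates in the rows whose digit is that of the failed node;
  by \<open>repair_unique\<close> any codeword matching these data has the right content at
  \<open>i\<close>.\<close>

lemma access_upper_bound:
  assumes i: "i \<in> {1..n}" and R: "R \<subseteq> {1..n} - {i}"
    and G: "G = {j \<in> {1..n}. group_of s j = group_of s i}" "G - {i} \<subseteq> R" "k \<le> card (R - G)"
  shows "repairable_by_access l code i R
    (card R * card {a. a < l \<and> dig a (group_of s i) = pos_of s i})"
proof -
  define S where "S = {a. a < l \<and> dig a (group_of s i) = pos_of s i}"
  define f where "f x = vec l (\<lambda>a. if a \<in> S then x $ a else 0)" for x :: "'a vec"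
  \<comment> \<open>Decoding picks some matching codeword; the zero vector is a default that keeps
    \<open>g\<close> inside \<open>carrier_vec l\<close> on data from no codeword.\<close>
  define g where "g y = (if \<exists>C\<in>code. y = (\<lambda>j\<in>R. f (C j))
    then (SOME C. C \<in> code \<and> y = (\<lambda>j\<in>R. f (C j))) i else 0\<^sub>v l)" for y
  have "C i = g (\<lambda>j\<in>R. f (C j))" if C: "C \<in> code" for C
  proof -
    define D where "D = (SOME D. D \<in> code \<and> (\<lambda>j\<in>R. f (C j)) = (\<lambda>j\<in>R. f (D j)))"
    have D: "D \<in> code" "(\<lambda>j\<in>R. f (C j)) = (\<lambda>j\<in>R. f (D j))"
      using someI[of "\<lambda>D. D \<in> code \<and> (\<lambda>j\<in>R. f (C j)) = (\<lambda>j\<in>R. f (D j))" C] C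
      by (auto simp: D_def)
    have "C i = D i"
    proof (rule repair_unique[OF i R G C D(1)])
      fix j a assume ja: "j \<in> R" "a < l" "dig a (group_of s i) = pos_of s i"
      have "f (C j) = f (D j)" using fun_cong[OF D(2), of j] ja by simp
      then have "f (C j) $ a = f (D j) $ a" by simp
      then show "C j $ a = D j $ a" using ja by (simp add: f_def S_def)
    qed
    then show ?thesis using C by (auto simp: g_def D_def)
  qed
  moreover have "g y \<in> carrier_vec l" for y
  proof (cases "\<exists>C\<in>code. y = (\<lambda>j\<in>R. f (C j))")
    case True
    then have "(SOME C. C \<in> code \<and> y = (\<lambda>j\<in>R. f (C j))) \<in> code"
      by (metis (mono_tags, lifting) someI_ex)
    from code_carrier[OF this i] show ?thesis using True by (simp add: g_def)
  qed (auto simp: g_def)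
  moreover have "depends_on_coords l S f"
    by (auto simp: depends_on_coords_def f_def)
  moreover have "S \<subseteq> {..<l}" by (auto simp: S_def)
  ultimately show ?thesis
    unfolding repairable_by_access_def S_def[symmetric]
    \<comment> \<open>The masked vectors keep length \<open>l\<close>, so each
      \<open>\<beta> j\<close> is \<open>l\<close>, while only \<open>card S\<close> coordinates are
      accessed.\<close>
    by (intro exI[of _ "\<lambda>_. l"] exI[of _ "\<lambda>_. card S"] exI[of _ "\<lambda>_. f"] exI[of _ g])
       (auto simp: f_def)
qed

lemma min_access_eq:
  assumes i: "i \<in> {1..n}" and R: "R \<subseteq> {1..n} - {i}" "card R = s + k - 1"
    and G: "G = {j \<in> {1..n}. group_of s j = group_of s i}" "G - {i} \<subseteq> R" "card G = s"
    and k0: "k = 0 \<Longrightarrow> s = 1"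
  shows "s * min_access l code i R = card R * l"
proof -
  define c where "c = card {a. a < l \<and> dig a (group_of s i) = pos_of s i}"
  have c: "s * c = l"
    unfolding c_def by (rule card_digit_class) (use group_of_in[OF i] s_pos in auto)
  have "finite R" "finite G" using R G by (auto intro: finite_subset)
  have "i \<in> G" using i G by simp
  then have "R \<inter> G = G - {i}" using R G by auto
  then have "card (R \<inter> G) = s - 1" using \<open>i \<in> G\<close> \<open>finite G\<close> G by simp
  moreover have "card (R - G) = card R - card (R \<inter> G)"
    using \<open>finite R\<close> by (simp add: card_Diff_subset_Int)
  \<comment> \<open>Of the \<open>s + k - 1\<close> helpers, exactly \<open>s - 1\<close> lie in the
    group, which leaves \<open>k\<close>.\<close>
  ultimately have "k \<le> card (R - G)" using R s_pos by simp
  then have "repairable_by_access l code i R (card R * c)"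
    unfolding c_def by (intro access_upper_bound[OF i R(1) G(1,2)])
  moreover have "card R * c \<le> \<omega>" if "repairable_by_access l code i R \<omega>" for \<omega>
  \<comment> \<open>The counting bound needs \<open>k > 0\<close>. For \<open>k = 0\<close> the
    assumption gives \<open>s = 1\<close>, so \<open>card R = 0\<close> and the claim is
    trivial.\<close>
  proof (cases "k = 0")
    case False
    then have "card R * l \<le> s * \<omega>" using access_lower_bound[OF i R] that by simp
    then have "s * (card R * c) \<le> s * \<omega>" by (simp add: c[symmetric] ac_simps)
    then show ?thesis using s_pos by simp
  qed (use R k0 in simp)
  ultimately have "min_access l code i R = card R * c"
    unfolding min_access_def by (rule Least_equality)
  then show ?thesis by (simp add: c[symmetric])
qed

end

section \<open>The partition into groups, and the conclusion\<close>

lemma partition_node_groups: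
  assumes s: "s > 0"
  shows "partition_on {1..s * m} (node_groups s m)"
proof (rule partition_onI)
  have G: "node_groups s m = (\<lambda>v. {j \<in> {1..s * m}. group_of s j = v}) ` {1..m}"
    unfolding node_groups_def using s by (intro image_cong refl node_groups_eq) auto
  show "\<Union> (node_groups s m) = {1..s * m}"
    unfolding G using group_of_in by fastforce
  show "disjnt A B" if "A \<in> node_groups s m" "B \<in> node_groups s m" "A \<noteq> B" for A B
    using that unfolding G by (auto simp: disjnt_def)
  show "{} \<notin> node_groups s m"
  proof
    assume "{} \<in> node_groups s m"
    then obtain v where "v \<in> {1..m}" "{(v - 1) * s + 1..v * s} = {}"
      unfolding node_groups_def by blast
    with s show False by (cases v) auto
  qed
qed

text \<open>The condition on \<open>r = s * m\<close> excludes \<open>k = 0\<close> with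
  \<open>s > 1\<close>, where repair accesses no symbol although \<open>d * l / s\<close> is
  positive.\<close>

theorem theorem8:
  fixes s r m n k l :: nat
    and \<gamma> :: "'a::{field,finite}"
    and lam :: "nat \<Rightarrow> 'a"
  assumes "s > 0" and "r > 0" and "m > 0"
    and "s \<le> r" and "r \<le> s * m"
    and "r = s * m \<longrightarrow> s = 1"
    and "n = s * m" and "k = n - r" and "l = s ^ m"
    and "CARD('a) \<ge> n"
    and "inj_on lam {1..n}"
    and "\<gamma> \<noteq> 0" and "\<gamma> \<noteq> 1"
  shows "group_optimal_access s (s + k - 1) n k l (node_groups s m) (the_code s r m \<gamma> lam)"
proof -
  interpret coupled_code s m r \<gamma> lam
    by unfold_locales (use assms in auto)
  have card_group: "card G = s" if "G \<in> node_groups s m" for G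
  proof -
    from that obtain v where v: "v \<in> {1..m}" "G = {(v - 1) * s + 1..v * s}"
      by (auto simp: node_groups_def)
    then show ?thesis by (cases v) auto
  qed
  have "real (min_access l (the_code s r m \<gamma> lam) i R) = real (s + k - 1) * real l / real s"
    if G: "G \<in> node_groups s m" "i \<in> G" and R: "R \<subseteq> {1..n} - {i}" "card R = s + k - 1" "G - {i} \<subseteq> R"
    for G i R
  proof -
    from G obtain v where v: "v \<in> {1..m}" "G = {(v - 1) * s + 1..v * s}"
      by (auto simp: node_groups_def)
    then have G': "G = {j \<in> {1..s * m}. group_of s j = v}"
      using node_groups_eq assms(1) by blast
    then have i: "i \<in> {1..s * m}" "group_of s i = v" using G(2) by auto
    have "s * min_access (s ^ m) (the_code s r m \<gamma> lam) i R = card R * s ^ m"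
    proof (rule min_access_eq[OF i(1)])
      show "G = {j \<in> {1..s * m}. group_of s j = group_of s i}" unfolding i(2) by (rule G')
      show "R \<subseteq> {1..s * m} - {i}" "card R = s + (s * m - r) - 1"
        using R(1,2) unfolding assms(7-9) .
      show "G - {i} \<subseteq> R" by (rule R(3))
      show "card G = s" by (rule card_group[OF G(1)])
      show "s * m - r = 0 \<Longrightarrow> s = 1" using assms(5,6) by simp
    qed
    then have "real s * real (min_access l (the_code s r m \<gamma> lam) i R) = real (s + k - 1) * real l"
      unfolding R(2)[symmetric] assms(9) of_nat_mult[symmetric] by simp
    then show ?thesis using assms(1) by (simp add: field_simps)
  qed
  then show ?thesis
    unfolding group_optimal_access_def
    using mds_code partition_node_groups[OF assms(1)] card_group assms by blast
qed

end
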